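(* The $\mathbb{K}$-linear span of the family $\Psi=(\Psi_{\mathbf{a}})_{\mathbf{a}\in\mathrm{Cmp}}$ of functions $\Psi_{\mathbf{a}}:\mathrm{evC}\to\mathbb{K}$, $X\mapsto\langle\mathsf{SS}(\delta X),\mathbf{a}\rangle$, is a $\mathbb{K}$-subalgebra of the algebra $\mathbb{K}^{\mathrm{evC}}$ of all functions $\mathrm{evC}\to\mathbb{K}$ (with pointwise operations).
   Context: $\mathbb{K}$ is an integral domain, $\mathbb{N}=\{1,2,\ldots\}$, $d\in\mathbb{N}$ is fixed; $\mathbb{N}^2$ carries the product order. $(\mathfrak{M}_d,\star,\varepsilon)$ is the free commutative monoid generated by $d$ letters $\mathbf{1},\ldots,\mathbf{d}$. A non-empty matrix composition is a matrix $\mathbf{a}\in\mathfrak{M}_d^{m\times n}$ ($m,n\geq1$) such that no row and no column consists only of entries $\varepsilon$. $\mathrm{Cmp}$ is the set of all these matrices together with an additional element $\mathsf{e}$, the empty composition. $\mathrm{evC}$ is the $\mathbb{K}$-module of eventually constant functions $X:\mathbb{N}^2\to\mathbb{K}^d$, i.e. those for which there is $\boldsymbol{n}\in\mathbb{N}^2$ such that $X$ is constant on $\{\boldsymbol{i}\in\mathbb{N}^2\mid\boldsymbol{i}\not\leq\boldsymbol{n}\}$. $\mathrm{evZ}\subseteq\mathrm{evC}$ is the submodule of functions of finite support. The difference operator $\delta:\mathrm{evC}\to\mathrm{evZ}$ is $(\delta X)_{i,j}=X_{i+1,j+1}-X_{i+1,j}-X_{i,j+1}+X_{i,j}$. For $z\in\mathbb{K}^d$,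 $\lambda\mapsto z^{(\lambda)}$ is the monoid homomorphism from $\mathfrak{M}_d$ to the multiplicative monoid of $\mathbb{K}$ with $z^{(\mathbf{j})}=z_j$ for every letter $\mathbf{j}$. For $Z\in\mathrm{evZ}$ and non-empty $\mathbf{a}\in\mathrm{Cmp}$ of size $m\times n$, $$\langle\mathsf{SS}(Z),\mathbf{a}\rangle=\sum_{\substack{1\leq\iota_1<\cdots<\iota_m\\1\leq\kappa_1<\cdots<\kappa_n}}\ \prod_{s=1}^{m}\prod_{t=1}^{n}Z_{\iota_s,\kappa_t}^{(\mathbf{a}_{s,t})}$$ (a sum with finitely many non-zero terms), and $\langle\mathsf{SS}(Z),\mathsf{e}\rangle=1$. *)

theory Defs
  imports
    "HOL-Library.Multiset"
    "HOL-Library.FuncSet"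
    "HOL-Library.Function_Algebras"
    "HOL-Library.Product_Order"
    "Jordan_Normal_Form.Matrix"
    "HOL-Analysis.Analysis"
begin

text \<open>
  The letters are the elements of a finite type \<open>'d\<close>, so that the fixed number \<open>d \<ge> 1\<close> is
  \<open>CARD('d)\<close>, \<open>\<bbbK>\<^sup>d\<close> is \<open>'k ^ 'd\<close>, and the free commutative monoid on \<open>d\<close> letters is
  \<open>'d multiset\<close>, with \<open>{#}\<close> as its neutral element \<open>\<epsilon>\<close>.
\<close>

definition monomial :: "'k::comm_monoid_mult ^ 'd \<Rightarrow> 'd multiset \<Rightarrow> 'k"
  where "monomial z w = (\<Prod>j\<in>#w. vec_nth z j)"

definition nonempty_matrix_compositions :: "'d multiset mat set"
  where "nonempty_matrix_compositions =
    {a. dim_row a \<ge> 1 \<and> dim_col a \<ge> 1 \<and>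
        (\<forall>s<dim_row a. \<exists>t<dim_col a. a $$ (s, t) \<noteq> {#}) \<and>
        (\<forall>t<dim_col a. \<exists>s<dim_row a. a $$ (s, t) \<noteq> {#})}"

text \<open>\<open>None\<close> is the empty composition \<open>\<e>\<close>.\<close>

definition Cmp :: "'d multiset mat option set"
  where "Cmp = insert None (Some ` nonempty_matrix_compositions)"

text \<open>
  Functions on \<open>\<nat>\<^sup>2\<close> with \<open>\<nat> = {1, 2, \<dots>}\<close> are functions on pairs of type \<^typ>\<open>nat\<close>
  that take the dummy value \<^const>\<open>undefined\<close> whenever a coordinate is zero.
\<close>

definition Npos2 :: "(nat \<times> nat) set"
  where "Npos2 = {1..} \<times> {1..}"

definition evC_funs :: "(nat \<times> nat \<Rightarrow> 'k ^ 'd) set"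
  where "evC_funs =
    {X \<in> extensional Npos2. \<exists>n\<in>Npos2. X constant_on {i \<in> Npos2. \<not> i \<le> n}}"

definition evZ_funs :: "(nat \<times> nat \<Rightarrow> 'k::zero ^ 'd) set"
  where "evZ_funs = {Z \<in> extensional Npos2. finite {i \<in> Npos2. Z i \<noteq> 0}}"

typedef ('k, 'd::finite) evC = "evC_funs :: (nat \<times> nat \<Rightarrow> 'k ^ 'd) set"
proof
  show "(\<lambda>i\<in>Npos2. undefined) \<in> (evC_funs :: (nat \<times> nat \<Rightarrow> 'k ^ 'd) set)"
    by (auto simp: evC_funs_def constant_on_def Npos2_def intro!: bexI[of _ "(1, 1)"])
qed

definition \<delta> :: "('k::ab_group_add, 'd::finite) evC \<Rightarrow> nat \<times> nat \<Rightarrow> 'k ^ 'd"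
  where "\<delta> X = (\<lambda>(i, j)\<in>Npos2.
    Rep_evC X (i + 1, j + 1) - Rep_evC X (i + 1, j) - Rep_evC X (i, j + 1) + Rep_evC X (i, j))"

definition strict_chains :: "nat \<Rightarrow> nat list set"
  where "strict_chains m = {\<iota>. length \<iota> = m \<and> set \<iota> \<subseteq> {1..} \<and> sorted_wrt (<) \<iota>}"

definition SS_term :: "(nat \<times> nat \<Rightarrow> 'k::comm_monoid_mult ^ 'd) \<Rightarrow> 'd multiset mat \<Rightarrow>
    nat list \<times> nat list \<Rightarrow> 'k"
  where "SS_term Z a = (\<lambda>(\<iota>, \<kappa>).
    \<Prod>s<dim_row a. \<Prod>t<dim_col a. monomial (Z (\<iota> ! s, \<kappa> ! t)) (a $$ (s, t)))"

text \<open>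
  List positions and matrix indices count from zero, so \<open>\<iota> ! s\<close> is \<open>\<iota>\<^bsub>s+1\<^esub>\<close>; the entries of
  \<open>\<iota>\<close> and \<open>\<kappa>\<close> start from one. The sum ranges over an infinite set; \<^const>\<open>sum'\<close> adds up the non-zero terms, and there are
  only finitely many of them by \<open>finite_SS_terms\<close> below.
\<close>

fun SS :: "(nat \<times> nat \<Rightarrow> 'k::comm_semiring_1 ^ 'd) \<Rightarrow> 'd multiset mat option \<Rightarrow> 'k"
  where
    "SS Z None = 1"
  | "SS Z (Some a) = sum' (SS_term Z a) (strict_chains (dim_row a) \<times> strict_chains (dim_col a))"

definition \<Psi> :: "'d::finite multiset mat option \<Rightarrow> ('k::comm_ring_1, 'd) evC \<Rightarrow> 'k"
  where "\<Psi> a = (\<lambda>X. SS (\<delta> X) a)"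

text \<open>
  Addition, multiplication and unit of an algebra of functions are the pointwise ones of the
  type class instances for functions; a subalgebra contains the unit.
\<close>

definition fun_scale :: "'k::comm_ring_1 \<Rightarrow> ('x \<Rightarrow> 'k) \<Rightarrow> 'x \<Rightarrow> 'k"
  where "fun_scale c f = (\<lambda>x. c * f x)"

interpretation fun_module: Modules.module "fun_scale :: 'k::comm_ring_1 \<Rightarrow> ('x \<Rightarrow> 'k) \<Rightarrow> 'x \<Rightarrow> 'k"
  by unfold_locales (auto simp: fun_scale_def fun_eq_iff algebra_simps)

definition is_subalgebra :: "('x \<Rightarrow> 'k::comm_ring_1) set \<Rightarrow> bool"
  where "is_subalgebra A \<longleftrightarrow>
    Modules.module.subspace fun_scale A \<and> 1 \<in> A \<and> (\<forall>f\<in>A. \<forall>g\<in>A. f * g \<in> A)"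

lemma evZ_funs_subset_evC_funs: "evZ_funs \<subseteq> (evC_funs :: (nat \<times> nat \<Rightarrow> 'k::zero ^ 'd) set)"
proof
  fix Z :: "nat \<times> nat \<Rightarrow> 'k ^ 'd"
  assume Z: "Z \<in> evZ_funs"
  define S where "S = {i \<in> Npos2. Z i \<noteq> 0}"
  have fin: "finite S" using Z by (simp add: evZ_funs_def S_def)
  define N where "N = Suc (\<Sum>i\<in>S. fst i + snd i)"
  have "i \<le> (N, N)" if "i \<in> S" for i
    using member_le_sum[of i S "\<lambda>i. fst i + snd i"] that fin
    by (auto simp: N_def less_eq_prod_def)
  then have "Z constant_on {i \<in> Npos2. \<not> i \<le> (N, N)}"
    unfolding constant_on_def S_def by blast
  moreover have "(N, N) \<in> Npos2" by (simp add: Npos2_def N_def)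
  ultimately show "Z \<in> evC_funs"
    using Z by (auto simp: evC_funs_def evZ_funs_def)
qed

lemma \<delta>_in_evZ_funs: "\<delta> X \<in> evZ_funs"
proof -
  obtain n c where "\<forall>i\<in>{i \<in> Npos2. \<not> i \<le> n}. Rep_evC X i = c"
    using Rep_evC[of X] unfolding evC_funs_def constant_on_def by blast
  moreover obtain n1 n2 where "n = (n1, n2)" by fastforce
  ultimately have c: "Rep_evC X (i, j) = c" if "i \<ge> 1" "j \<ge> 1" "\<not> (i \<le> n1 \<and> j \<le> n2)" for i j
    using that by (simp add: Npos2_def)
  have "{i \<in> Npos2. \<delta> X i \<noteq> 0} \<subseteq> {..n1} \<times> {..n2}"
  proof clarify
    fix i j
    assume ij: "(i, j) \<in> Npos2" and nz: "\<delta> X (i, j) \<noteq> 0"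
    show "i \<in> {..n1} \<and> j \<in> {..n2}"
    proof (rule ccontr)
      assume "\<not> ?thesis"
      then show False using ij nz by (auto simp: \<delta>_def Npos2_def c)
    qed
  qed
  then have "finite {i \<in> Npos2. \<delta> X i \<noteq> 0}" by (rule finite_subset) simp
  moreover have "\<delta> X \<in> extensional Npos2" by (simp add: \<delta>_def)
  ultimately show ?thesis by (simp add: evZ_funs_def)
qed

lemma finite_SS_terms:
  fixes Z :: "nat \<times> nat \<Rightarrow> 'k::comm_semiring_1 ^ 'd"
  assumes Z: "Z \<in> evZ_funs" and a: "a \<in> nonempty_matrix_compositions"
  shows "finite {x \<in> strict_chains (dim_row a) \<times> strict_chains (dim_col a). SS_term Z a x \<noteq> 0}"
proof -
  define S where "S = {i \<in> Npos2. Z i \<noteq> 0}"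
  have fin: "finite S" using Z by (simp add: evZ_funs_def S_def)
  have "{x \<in> strict_chains (dim_row a) \<times> strict_chains (dim_col a). SS_term Z a x \<noteq> 0}
      \<subseteq> {\<iota>. set \<iota> \<subseteq> fst ` S \<and> length \<iota> = dim_row a} \<times>
        {\<kappa>. set \<kappa> \<subseteq> snd ` S \<and> length \<kappa> = dim_col a}"
  proof
    fix x
    assume "x \<in> {x \<in> strict_chains (dim_row a) \<times> strict_chains (dim_col a). SS_term Z a x \<noteq> 0}"
    then obtain \<iota> \<kappa> where x: "x = (\<iota>, \<kappa>)"
      and i: "\<iota> \<in> strict_chains (dim_row a)" and k: "\<kappa> \<in> strict_chains (dim_col a)"
      and nz: "SS_term Z a (\<iota>, \<kappa>) \<noteq> 0"
      by auto
    have len: "length \<iota> = dim_row a" "length \<kappa> = dim_col a"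
      using i k by (auto simp: strict_chains_def)
    have mem: "(\<iota> ! s, \<kappa> ! t) \<in> S"
      if s: "s < dim_row a" and t: "t < dim_col a" and ne: "a $$ (s, t) \<noteq> {#}" for s t
    proof -
      have "monomial (Z (\<iota> ! s, \<kappa> ! t)) (a $$ (s, t)) \<noteq> 0"
      proof
        assume 0: "monomial (Z (\<iota> ! s, \<kappa> ! t)) (a $$ (s, t)) = 0"
        have "(\<Prod>t<dim_col a. monomial (Z (\<iota> ! s, \<kappa> ! t)) (a $$ (s, t))) = 0"
          using t 0 by (intro prod_zero) auto
        then have "SS_term Z a (\<iota>, \<kappa>) = 0"
          unfolding SS_term_def prod.case using s by (intro prod_zero) auto
        then show False using nz by simp
      qed
      moreover have "monomial 0 (a $$ (s, t)) = (0 :: 'k)"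
        using ne by (cases "a $$ (s, t)") (auto simp: monomial_def)
      ultimately have "Z (\<iota> ! s, \<kappa> ! t) \<noteq> 0" by metis
      moreover have "\<iota> ! s \<in> {1..}" "\<kappa> ! t \<in> {1..}"
        using i k s t by (auto simp: strict_chains_def subset_iff Ball_def)
      ultimately show ?thesis by (simp add: S_def Npos2_def)
    qed
    have "x \<in> fst ` S" if "x \<in> set \<iota>" for x
    proof -
      obtain s where s: "s < dim_row a" "x = \<iota> ! s"
        using \<open>x \<in> set \<iota>\<close> len by (metis in_set_conv_nth)
      then obtain t where "t < dim_col a" "a $$ (s, t) \<noteq> {#}"
        using a by (auto simp: nonempty_matrix_compositions_def)
      then show ?thesis using mem s by force
    qed
    moreover have "x \<in> snd ` S" if "x \<in> set \<kappa>" for x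
    proof -
      obtain t where t: "t < dim_col a" "x = \<kappa> ! t"
        using \<open>x \<in> set \<kappa>\<close> len by (metis in_set_conv_nth)
      then obtain s where "s < dim_row a" "a $$ (s, t) \<noteq> {#}"
        using a by (auto simp: nonempty_matrix_compositions_def)
      then show ?thesis using mem t by force
    qed
    ultimately show "x \<in> {\<iota>. set \<iota> \<subseteq> fst ` S \<and> length \<iota> = dim_row a} \<times>
        {\<kappa>. set \<kappa> \<subseteq> snd ` S \<and> length \<kappa> = dim_col a}"
      using len x by blast
  qed
  then show ?thesis
    by (rule finite_subset) (intro finite_cartesian_product finite_lists_length_eq finite_imageI fin)
qed

end

theory Submission
  imports Defs
begin

text \<open>
  Treat the coordinates of the values \<open>Z\<^bsub>i,j\<^esub>\<close> as commuting variables, one for each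
  position \<open>(i, j)\<close> and letter \<open>l\<close>. A monomial in them is a finite multiset of pairs
  \<open>((i, j), l)\<close>. Call two monomials equivalent if one arises from the other by relabelling rows and
  columns in an order-preserving way. The summands of \<open>\<langle>SS(Z), a\<rangle>\<close> are the monomials
  obtained by placing the entries of \<open>a\<close> in increasing rows \<open>\<iota>\<close> and increasing columns
  \<open>\<kappa>\<close>. As \<open>a\<close> has no empty row and no empty column, the monomial determines
  \<open>\<iota>\<close> and \<open>\<kappa>\<close>, so these are exactly the members of one equivalence class, each
  counted once. Deleting empty rows and columns shows that every class comes from exactly one
  composition, the class of the empty monomial from \<open>e\<close>.

  Hence the span of \<open>\<Psi>\<close> consists of the evaluations at \<open>\<delta> X\<close> of the power series
  of bounded degree whose coefficients are constant on the classes (lemma \<open>span_\<Psi>_eq_QSym_funs\<close>):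
  a two-parameter version of the quasisymmetric functions. Bounded degree corresponds to finite linear
  combinations because only finitely many compositions have a given total degree.

  Such series are closed under multiplication. The coefficient of \<open>w\<close> in a product is a sum over
  the factorizations \<open>w = u + v\<close>, and an order-preserving relabelling of \<open>w\<close> carries its
  factorizations bijectively to those of the relabelled monomial without changing the classes of the
  factors (lemma \<open>quasisymmetric_cauchy_product\<close>). Since \<open>\<delta> X\<close> has finite support,
  every evaluation is a finite sum and evaluation turns the Cauchy product into the pointwise one.
\<close>

section \<open>Power series of bounded degree at points of finite support\<close>

text \<open>
  A monomial in the variables \<open>'v\<close> is a finite multiset of variables, so that multiplication of monomials
  is addition of multisets; a power series is its coefficient function.
\<close>

definition monom_at :: "('v \<Rightarrow> 'k::comm_semiring_1) \<Rightarrow> 'v multiset \<Rightarrow> 'k"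
  where "monom_at x w = (\<Prod>p\<in>#w. x p)"

definition eval_series :: "('v multiset \<Rightarrow> 'k::comm_semiring_1) \<Rightarrow> ('v \<Rightarrow> 'k) \<Rightarrow> 'k"
  where "eval_series f x = sum' (\<lambda>w. f w * monom_at x w) UNIV"

definition degree_le :: "('v multiset \<Rightarrow> 'k::zero) \<Rightarrow> nat \<Rightarrow> bool"
  where "degree_le f n \<longleftrightarrow> (\<forall>w. f w \<noteq> 0 \<longrightarrow> size w \<le> n)"

definition msets_le :: "'v set \<Rightarrow> nat \<Rightarrow> 'v multiset set"
  where "msets_le S n = {w. set_mset w \<subseteq> S \<and> size w \<le> n}"

definition cauchy_product ::
    "('v multiset \<Rightarrow> 'k::comm_semiring_1) \<Rightarrow> ('v multiset \<Rightarrow> 'k) \<Rightarrow> 'v multiset \<Rightarrow> 'k"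
  where "cauchy_product f g w = (\<Sum>u | u \<subseteq># w. f u * g (w - u))"

lemma finite_msets_le: "finite S \<Longrightarrow> finite (msets_le S n)"
proof -
  assume S: "finite S"
  have "msets_le S n = (\<Union>k\<le>n. multisets_of_size S k)"
    by (auto simp: msets_le_def multisets_of_size_def)
  then show ?thesis using S by auto
qed

lemma finite_submultisets: "finite {u. u \<subseteq># w}"
proof (rule finite_subset)
  show "{u. u \<subseteq># w} \<subseteq> msets_le (set_mset w) (size w)"
    by (auto simp: msets_le_def size_mset_mono dest: mset_subset_eqD)
qed (simp add: finite_msets_le)

lemma monom_at_plus: "monom_at x (u + v) = monom_at x u * monom_at x v"
  by (simp add: monom_at_def)

lemma set_mset_if_monom_at_nonzero:
  assumes "monom_at x w \<noteq> 0"
  shows "set_mset w \<subseteq> {p. x p \<noteq> 0}"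
proof
  fix p assume "p \<in># w"
  then obtain v where "w = add_mset p v" by (metis multi_member_split)
  then show "p \<in> {p. x p \<noteq> 0}" using assms by (auto simp: monom_at_def)
qed

lemma eval_series_eq_sum:
  assumes "finite A" and "\<And>w. f w * monom_at x w \<noteq> 0 \<Longrightarrow> w \<in> A"
  shows "eval_series f x = (\<Sum>w\<in>A. f w * monom_at x w)"
proof -
  have sub: "{w \<in> UNIV. f w * monom_at x w \<noteq> 0} \<subseteq> A" using assms(2) by blast
  then have "finite {w \<in> UNIV. f w * monom_at x w \<noteq> 0}"
    using assms(1) by (rule finite_subset)
  then show ?thesis unfolding eval_series_def sum.G_def
    using sub assms(1) by (auto intro!: sum.mono_neutral_left)
qed

lemma eval_series_eq_sum_msets_le:
  assumes "finite {p. x p \<noteq> 0}" "degree_le f n" "n \<le> N"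
  shows "eval_series f x = (\<Sum>w\<in>msets_le {p. x p \<noteq> 0} N. f w * monom_at x w)"
proof (rule eval_series_eq_sum)
  fix w assume "f w * monom_at x w \<noteq> 0"
  then have "f w \<noteq> 0" "monom_at x w \<noteq> 0" by auto
  then show "w \<in> msets_le {p. x p \<noteq> 0} N"
    using assms(2,3) set_mset_if_monom_at_nonzero
    unfolding msets_le_def degree_le_def mem_Collect_eq by (metis order.trans)
qed (simp add: assms finite_msets_le)

lemma eval_series_linear_combination:
  assumes "finite {p. x p \<noteq> 0}" "\<And>c. c \<in> C \<Longrightarrow> degree_le (g c) n"
  shows "eval_series (\<lambda>w. \<Sum>c\<in>C. r c * g c w) x = (\<Sum>c\<in>C. r c * eval_series (g c) x)"
proof -
  have "degree_le (\<lambda>w. \<Sum>c\<in>C. r c * g c w) n"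
    unfolding degree_le_def
  proof (intro allI impI)
    fix w assume "(\<Sum>c\<in>C. r c * g c w) \<noteq> 0"
    then obtain c where "c \<in> C" "r c * g c w \<noteq> 0" by (metis (no_types, lifting) sum.neutral)
    then show "size w \<le> n" using assms(2) by (metis degree_le_def mult_zero_right)
  qed
  from eval_series_eq_sum_msets_le[OF assms(1) this order.refl]
  have "eval_series (\<lambda>w. \<Sum>c\<in>C. r c * g c w) x
      = (\<Sum>w\<in>msets_le {p. x p \<noteq> 0} n. \<Sum>c\<in>C. r c * g c w * monom_at x w)"
    by (simp add: sum_distrib_right)
  also have "\<dots> = (\<Sum>c\<in>C. r c * (\<Sum>w\<in>msets_le {p. x p \<noteq> 0} n. g c w * monom_at x w))"
    by (subst sum.swap) (simp add: sum_distrib_left mult.assoc)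
  also have "\<dots> = (\<Sum>c\<in>C. r c * eval_series (g c) x)"
    by (rule sum.cong[OF refl])
      (simp add: eval_series_eq_sum_msets_le[OF assms(1) assms(2) order.refl])
  finally show ?thesis .
qed

lemma degree_le_cauchy_product:
  assumes "degree_le f n" "degree_le g m"
  shows "degree_le (cauchy_product f g) (n + m)"
  unfolding degree_le_def
proof (intro allI impI)
  fix w assume "cauchy_product f g w \<noteq> 0"
  then obtain u where u: "u \<subseteq># w" "f u * g (w - u) \<noteq> 0"
    unfolding cauchy_product_def by (metis (no_types, lifting) sum.neutral mem_Collect_eq)
  then have "f u \<noteq> 0" "g (w - u) \<noteq> 0" by auto
  then have "size u \<le> n" "size (w - u) \<le> m" using assms by (auto simp: degree_le_def)
  then show "size w \<le> n + m" using u(1) by (simp add: size_Diff_submset)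
qed

text \<open>
  Regroup the double sum over \<open>(u, v)\<close> by \<open>w = u + v\<close>. All sums are cut down to the finitely many
  monomials of bounded degree in the variables at which \<open>x\<close> does not vanish.
\<close>

lemma eval_series_cauchy_product:
  assumes x: "finite {p. x p \<noteq> 0}" and f: "degree_le f n" and g: "degree_le g m"
  shows "eval_series (cauchy_product f g) x = eval_series f x * eval_series g x"
proof -
  define S where "S = {p. x p \<noteq> 0}"
  have fin: "finite (msets_le S k)" for k using x by (simp add: S_def finite_msets_le)
  have "eval_series (cauchy_product f g) x
      = (\<Sum>w\<in>msets_le S (n + m). \<Sum>u | u \<subseteq># w. f u * g (w - u) * monom_at x w)"
    unfolding S_def
      eval_series_eq_sum_msets_le[OF x degree_le_cauchy_product[OF f g] order.refl]
    by (simp add: cauchy_product_def sum_distrib_right)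
  also have "\<dots> = (\<Sum>(w, u)\<in>(SIGMA w:msets_le S (n + m). {u. u \<subseteq># w}).
      f u * g (w - u) * monom_at x w)"
    by (rule sum.Sigma) (auto simp: fin finite_submultisets)
  \<comment> \<open>Factorizations of degree beyond \<open>(n, m)\<close> occur on the left only; they carry coefficient zero.\<close>
  also have "\<dots> = (\<Sum>(u, v)\<in>msets_le S n \<times> msets_le S m.
      f u * monom_at x u * (g v * monom_at x v))"
  proof (rule sum.reindex_bij_witness_not_neutral[where
        S' = "{(w, u) \<in> (SIGMA w:msets_le S (n + m). {u. u \<subseteq># w}).
          \<not> (size u \<le> n \<and> size (w - u) \<le> m)}" and T' = "{}" and
        j = "\<lambda>(w, u). (u, w - u)" and i = "\<lambda>(u, v). (u + v, u)"])
    show "finite {(w, u) \<in> (SIGMA w:msets_le S (n + m). {u. u \<subseteq># w}).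
          \<not> (size u \<le> n \<and> size (w - u) \<le> m)}"
      by (rule finite_subset[of _ "SIGMA w:msets_le S (n + m). {u. u \<subseteq># w}"])
        (auto simp: fin finite_submultisets)
  next
    fix a assume "a \<in> (SIGMA w:msets_le S (n + m). {u. u \<subseteq># w})
      - {(w, u) \<in> (SIGMA w:msets_le S (n + m). {u. u \<subseteq># w}).
          \<not> (size u \<le> n \<and> size (w - u) \<le> m)}"
    then obtain w u where a: "a = (w, u)" "u \<subseteq># w" "w \<in> msets_le S (n + m)"
        "size u \<le> n" "size (w - u) \<le> m"
      by auto
    then show "(case (case a of (w, u) \<Rightarrow> (u, w - u)) of (u, v) \<Rightarrow> (u + v, u)) = a"
      and "(case a of (w, u) \<Rightarrow> (u, w - u)) \<in> msets_le S n \<times> msets_le S m - {}"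
      by (auto simp: msets_le_def dest: mset_subset_eqD in_diffD)
  next
    fix a assume "a \<in> {(w, u) \<in> (SIGMA w:msets_le S (n + m). {u. u \<subseteq># w}).
          \<not> (size u \<le> n \<and> size (w - u) \<le> m)}"
    then show "(case a of (w, u) \<Rightarrow> f u * g (w - u) * monom_at x w) = 0"
      using f g by (force simp: degree_le_def)
  next
    fix a assume "a \<in> (SIGMA w:msets_le S (n + m). {u. u \<subseteq># w})"
    then obtain w u where a: "a = (w, u)" "u \<subseteq># w" by auto
    then have "monom_at x w = monom_at x u * monom_at x (w - u)"
      by (metis monom_at_plus subset_mset.add_diff_inverse)
    with a show "(case (case a of (w, u) \<Rightarrow> (u, w - u)) of
          (u, v) \<Rightarrow> f u * monom_at x u * (g v * monom_at x v))
        = (case a of (w, u) \<Rightarrow> f u * g (w - u) * monom_at x w)"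
      by (simp add: algebra_simps)
  qed (auto simp: msets_le_def)
  also have "\<dots> = eval_series f x * eval_series g x"
    by (simp add: eval_series_eq_sum_msets_le[OF x f order.refl]
        eval_series_eq_sum_msets_le[OF x g order.refl] S_def sum_product
        sum.cartesian_product)
  finally show ?thesis .
qed

section \<open>Quasisymmetric series\<close>

definition row_support :: "((nat \<times> nat) \<times> 'd) multiset \<Rightarrow> nat set"
  where "row_support w = (\<lambda>p. fst (fst p)) ` set_mset w"

definition col_support :: "((nat \<times> nat) \<times> 'd) multiset \<Rightarrow> nat set"
  where "col_support w = (\<lambda>p. snd (fst p)) ` set_mset w"

abbreviation relabel_var :: "(nat \<Rightarrow> nat) \<Rightarrow> (nat \<Rightarrow> nat) \<Rightarrow>
    (nat \<times> nat) \<times> 'd \<Rightarrow> (nat \<times> nat) \<times> 'd"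
  where "relabel_var \<phi> \<psi> \<equiv> map_prod (map_prod \<phi> \<psi>) id"

abbreviation relabel :: "(nat \<Rightarrow> nat) \<Rightarrow> (nat \<Rightarrow> nat) \<Rightarrow>
    ((nat \<times> nat) \<times> 'd) multiset \<Rightarrow> ((nat \<times> nat) \<times> 'd) multiset"
  where "relabel \<phi> \<psi> \<equiv> image_mset (relabel_var \<phi> \<psi>)"

text \<open>
  The relabelling needs to be increasing only on the rows and columns that occur in \<open>w\<close>. This is
  what makes the relation symmetric: the inverse relabelling is increasing on the image only.
\<close>

definition same_pattern ::
    "((nat \<times> nat) \<times> 'd) multiset \<Rightarrow> ((nat \<times> nat) \<times> 'd) multiset \<Rightarrow> bool"
  where "same_pattern w w' \<longleftrightarrow>
    (\<exists>\<phi> \<psi>. strict_mono_on (row_support w) \<phi> \<and> strict_mono_on (col_support w) \<psi> \<and> w' = relabel \<phi> \<psi> w)"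

definition quasisymmetric :: "(((nat \<times> nat) \<times> 'd) multiset \<Rightarrow> 'k) \<Rightarrow> bool"
  where "quasisymmetric f \<longleftrightarrow> (\<forall>w w'. same_pattern w w' \<longrightarrow> f w = f w')"

lemma row_support_relabel: "row_support (relabel \<phi> \<psi> w) = \<phi> ` row_support w"
  by (force simp: row_support_def)

lemma col_support_relabel: "col_support (relabel \<phi> \<psi> w) = \<psi> ` col_support w"
  by (force simp: col_support_def)

lemma relabel_relabel: "relabel \<phi>' \<psi>' (relabel \<phi> \<psi> w) = relabel (\<phi>' \<circ> \<phi>) (\<psi>' \<circ> \<psi>) w"
  unfolding image_mset.compositionality by (rule image_mset_cong) auto

lemma relabel_ident:
  assumes "\<And>i. i \<in> row_support w \<Longrightarrow> \<phi> i = i" "\<And>j. j \<in> col_support w \<Longrightarrow> \<psi> j = j"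
  shows "relabel \<phi> \<psi> w = w"
proof -
  have "relabel \<phi> \<psi> w = image_mset id w"
    using assms by (intro image_mset_cong) (force simp: row_support_def col_support_def)
  then show ?thesis by simp
qed

lemma strict_mono_on_inv_into:
  assumes "strict_mono_on A (f :: nat \<Rightarrow> nat)"
  shows "strict_mono_on (f ` A) (inv_into A f)"
proof (rule strict_mono_onI)
  fix r s assume "r \<in> f ` A" "s \<in> f ` A" "r < s"
  then obtain a b where ab: "a \<in> A" "b \<in> A" "r = f a" "s = f b" by auto
  have "a < b"
  proof (rule ccontr)
    assume "\<not> a < b"
    then have "b = a \<or> b < a" by auto
    then show False
      using strict_mono_onD[OF assms, of b a] ab \<open>r < s\<close> by auto
  qed
  then show "inv_into A f r < inv_into A f s"
    using ab strict_mono_on_imp_inj_on[OF assms] by simp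
qed

lemma same_pattern_sym:
  assumes "same_pattern w w'"
  shows "same_pattern w' w"
proof -
  obtain \<phi> \<psi> where 1: "strict_mono_on (row_support w) \<phi>" "strict_mono_on (col_support w) \<psi>"
      "w' = relabel \<phi> \<psi> w"
    using assms unfolding same_pattern_def by blast
  let ?\<phi> = "inv_into (row_support w) \<phi>" and ?\<psi> = "inv_into (col_support w) \<psi>"
  have "strict_mono_on (row_support w') ?\<phi>" "strict_mono_on (col_support w') ?\<psi>"
    using 1 strict_mono_on_inv_into by (auto simp: row_support_relabel col_support_relabel)
  moreover have "relabel ?\<phi> ?\<psi> w' = w"
    unfolding 1(3) relabel_relabel
    by (rule relabel_ident) (simp_all add: 1 strict_mono_on_imp_inj_on)
  ultimately show ?thesis unfolding same_pattern_def by metis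
qed

lemma same_pattern_trans:
  assumes "same_pattern w w'" "same_pattern w' w''"
  shows "same_pattern w w''"
proof -
  obtain \<phi> \<psi> \<phi>' \<psi>' where 1: "strict_mono_on (row_support w) \<phi>" "strict_mono_on (col_support w) \<psi>"
      "w' = relabel \<phi> \<psi> w" and 2: "strict_mono_on (row_support w') \<phi>'" "strict_mono_on (col_support w') \<psi>'"
      "w'' = relabel \<phi>' \<psi>' w'"
    using assms unfolding same_pattern_def by blast
  have "strict_mono_on (row_support w) (\<phi>' \<circ> \<phi>)" "strict_mono_on (col_support w) (\<psi>' \<circ> \<psi>)"
    using 1 2 by (auto simp: row_support_relabel col_support_relabel strict_mono_on_def)
  moreover have "w'' = relabel (\<phi>' \<circ> \<phi>) (\<psi>' \<circ> \<psi>) w" using 1 2 relabel_relabel by metis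
  ultimately show ?thesis unfolding same_pattern_def by blast
qed

lemma same_pattern_size: "same_pattern w w' \<Longrightarrow> size w' = size w"
  by (auto simp: same_pattern_def)

lemma inj_on_relabel_var:
  assumes "strict_mono_on (row_support w) \<phi>" "strict_mono_on (col_support w) \<psi>"
  shows "inj_on (relabel_var \<phi> \<psi>) (set_mset w)"
proof -
  have "inj_on \<phi> (row_support w)" "inj_on \<psi> (col_support w)"
    using assms strict_mono_on_imp_inj_on by auto
  then show ?thesis by (force simp: inj_on_def row_support_def col_support_def)
qed

lemma image_mset_inv_into_image:
  assumes "inj_on h A" "set_mset u \<subseteq> A"
  shows "image_mset (inv_into A h) (image_mset h u) = u"
proof -
  have "image_mset (inv_into A h) (image_mset h u) = image_mset id u"
    unfolding image_mset.compositionality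
    using assms by (intro image_mset_cong) (auto simp: subset_eq)
  then show ?thesis by simp
qed

text \<open>
  Without injectivity, \<open>image_mset h w\<close> can have submultisets that are the image of several
  submultisets of \<open>w\<close>.
\<close>

lemma bij_betw_submultisets_image:
  assumes "inj_on h (set_mset w)"
  shows "bij_betw (image_mset h) {u. u \<subseteq># w} {u. u \<subseteq># image_mset h w}"
proof (rule bij_betwI[where g = "image_mset (inv_into (set_mset w) h)"])
  let ?g = "inv_into (set_mset w) h"
  have w: "image_mset ?g (image_mset h w) = w"
    by (rule image_mset_inv_into_image[OF assms order.refl])
  show "image_mset h \<in> {u. u \<subseteq># w} \<rightarrow> {u. u \<subseteq># image_mset h w}"
    by (auto intro: image_mset_subseteq_mono)
  show "image_mset ?g \<in> {u. u \<subseteq># image_mset h w} \<rightarrow> {u. u \<subseteq># w}"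
    using image_mset_subseteq_mono[of _ "image_mset h w" ?g] w by auto
  show "image_mset ?g (image_mset h u) = u" if "u \<in> {u. u \<subseteq># w}" for u
    using image_mset_inv_into_image[OF assms] set_mset_mono that by blast
  show "image_mset h (image_mset ?g u) = u" if "u \<in> {u. u \<subseteq># image_mset h w}" for u
  proof -
    have "h (?g p) = p" if "p \<in># u" for p
    proof -
      have "p \<in> h ` set_mset w" using that \<open>u \<in> _\<close> by (auto dest: mset_subset_eqD)
      then show ?thesis by (rule f_inv_into_f)
    qed
    then have "image_mset h (image_mset ?g u) = image_mset id u"
      unfolding image_mset.compositionality by (intro image_mset_cong) simp
    then show ?thesis by simp
  qed
qed

text \<open>
  An order-preserving relabelling of \<open>w\<close> is injective on its variables and restricts to an
  order-preserving relabelling of every factor \<open>u\<close> and of its complement \<open>w - u\<close>, so it matches the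
  factorizations of equivalent monomials term by term.
\<close>

lemma quasisymmetric_cauchy_product:
  assumes "quasisymmetric f" "quasisymmetric g"
  shows "quasisymmetric (cauchy_product f g)"
  unfolding quasisymmetric_def
proof (intro allI impI)
  fix w w' :: "((nat \<times> nat) \<times> 'a) multiset"
  assume "same_pattern w w'"
  then obtain \<phi> \<psi> where 1: "strict_mono_on (row_support w) \<phi>" "strict_mono_on (col_support w) \<psi>"
      and w': "w' = relabel \<phi> \<psi> w"
    unfolding same_pattern_def by blast
  have inv: "h (relabel \<phi> \<psi> u) = h u" if "quasisymmetric h" "u \<subseteq># w" for h :: "_ \<Rightarrow> 'b" and u
  proof -
    have "row_support u \<subseteq> row_support w" "col_support u \<subseteq> col_support w"
      using set_mset_mono[OF that(2)] by (auto simp: row_support_def col_support_def)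
    then have "same_pattern u (relabel \<phi> \<psi> u)"
      using 1 unfolding same_pattern_def strict_mono_on_def by (metis subsetD)
    then show ?thesis using that(1) by (simp add: quasisymmetric_def)
  qed
  have "cauchy_product f g w' = (\<Sum>u | u \<subseteq># w. f (relabel \<phi> \<psi> u) * g (w' - relabel \<phi> \<psi> u))"
    unfolding cauchy_product_def w'
    by (rule sum.reindex_bij_betw[OF
        bij_betw_submultisets_image[OF inj_on_relabel_var[OF 1]], symmetric])
  also have "\<dots> = cauchy_product f g w"
    unfolding cauchy_product_def
    by (rule sum.cong[OF refl])
      (auto simp: w' inv assms image_mset_Diff[symmetric] diff_subset_eq_self)
  finally show "cauchy_product f g w = cauchy_product f g w'" ..
qed

section \<open>Compositions as patterns\<close>

text \<open>
  The representative of the class of a composition \<open>a\<close>: the monomial with the rows \<open>{..<dim_row a}\<close> and the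
  columns \<open>{..<dim_col a}\<close>. Its indices count from zero like those
  of the matrix, while the members of \<open>strict_chains\<close> count from one; equivalence of monomials is
  indifferent to this shift.
\<close>

definition mset_of_mat :: "'d multiset mat \<Rightarrow> ((nat \<times> nat) \<times> 'd) multiset"
  where "mset_of_mat a =
    (\<Sum>p\<in>{..<dim_row a} \<times> {..<dim_col a}. image_mset (Pair p) (a $$ p))"

definition mset_of_comp :: "'d multiset mat option \<Rightarrow> ((nat \<times> nat) \<times> 'd) multiset"
  where "mset_of_comp c = (case c of None \<Rightarrow> {#} | Some a \<Rightarrow> mset_of_mat a)"

lemma count_image_mset_Pair:
  "count (image_mset (Pair p) M) (q, l) = (if p = q then count M l else 0)"
  by (induction M) auto

lemma count_mset_of_mat:
  "count (mset_of_mat a) ((s, t), l) =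
    (if s < dim_row a \<and> t < dim_col a then count (a $$ (s, t)) l else 0)"
  by (auto simp: mset_of_mat_def count_sum count_image_mset_Pair)

lemma mem_mset_of_mat:
  "((s, t), l) \<in># mset_of_mat a \<longleftrightarrow> s < dim_row a \<and> t < dim_col a \<and> l \<in># a $$ (s, t)"
  unfolding count_greater_zero_iff[symmetric] count_mset_of_mat by auto

lemma row_support_mset_of_mat:
  assumes "a \<in> nonempty_matrix_compositions"
  shows "row_support (mset_of_mat a) = {..<dim_row a}"
proof (intro equalityI subsetI)
  fix s assume "s \<in> {..<dim_row a}"
  then obtain t where "s < dim_row a" "t < dim_col a" "a $$ (s, t) \<noteq> {#}"
    using assms by (auto simp: nonempty_matrix_compositions_def)
  then obtain l where "((s, t), l) \<in># mset_of_mat a"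
    by (meson mem_mset_of_mat multiset_nonemptyE)
  then show "s \<in> row_support (mset_of_mat a)" by (force simp: row_support_def)
qed (auto simp: row_support_def mem_mset_of_mat)

lemma col_support_mset_of_mat:
  assumes "a \<in> nonempty_matrix_compositions"
  shows "col_support (mset_of_mat a) = {..<dim_col a}"
proof (intro equalityI subsetI)
  fix t assume "t \<in> {..<dim_col a}"
  then obtain s where "s < dim_row a" "t < dim_col a" "a $$ (s, t) \<noteq> {#}"
    using assms by (auto simp: nonempty_matrix_compositions_def)
  then obtain l where "((s, t), l) \<in># mset_of_mat a"
    by (meson mem_mset_of_mat multiset_nonemptyE)
  then show "t \<in> col_support (mset_of_mat a)" by (force simp: col_support_def)
qed (auto simp: col_support_def mem_mset_of_mat)

text \<open>
  An initial segment of the natural numbers is order-isomorphic to another one only if they agree, and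
  then only by the identity: both enumerations are the sorted list of the same set.
\<close>

lemma strict_mono_on_lessThan_onto:
  assumes "strict_mono_on {..<m} \<phi>" "\<phi> ` {..<m} = {..<m'}"
  shows "m = m'" and "i < m \<Longrightarrow> \<phi> i = (i :: nat)"
proof -
  have "sorted_wrt (<) (map \<phi> [0..<m])"
    using assms(1) by (auto simp: sorted_wrt_iff_nth_less strict_mono_on_def)
  moreover have "set (map \<phi> [0..<m]) = set [0..<m']"
    using assms(2) by (simp add: atLeast0LessThan)
  ultimately have eq: "map \<phi> [0..<m] = [0..<m']"
    by (intro strict_sorted_equal) auto
  then show "m = m'" by (metis length_map length_upt minus_nat.diff_0)
  then show "\<phi> i = i" if "i < m" using eq that
    by (metis add_cancel_left_left diff_zero length_upt nth_map nth_upt)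
qed

text \<open>
  As there are no empty rows or columns, the rows and columns of the two representatives are full
  initial segments, so that the relabelling between them can only be the identity.
\<close>

lemma same_pattern_mset_of_mat_imp_eq:
  assumes "a \<in> nonempty_matrix_compositions" "b \<in> nonempty_matrix_compositions"
    and "same_pattern (mset_of_mat a) (mset_of_mat b)"
  shows "a = b"
proof -
  obtain \<phi> \<psi> where 1: "strict_mono_on {..<dim_row a} \<phi>" "strict_mono_on {..<dim_col a} \<psi>"
      and b: "mset_of_mat b = relabel \<phi> \<psi> (mset_of_mat a)"
    using assms unfolding same_pattern_def by (metis row_support_mset_of_mat col_support_mset_of_mat)
  have "\<phi> ` {..<dim_row a} = {..<dim_row b}" "\<psi> ` {..<dim_col a} = {..<dim_col b}"
    using row_support_relabel[of \<phi> \<psi> "mset_of_mat a"] col_support_relabel[of \<phi> \<psi> "mset_of_mat a"]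
      row_support_mset_of_mat col_support_mset_of_mat assms b by metis+
  note \<phi> = strict_mono_on_lessThan_onto[OF 1(1) this(1)]
    and \<psi> = strict_mono_on_lessThan_onto[OF 1(2) this(2)]
  have "mset_of_mat b = mset_of_mat a"
    unfolding b using \<phi>(2) \<psi>(2)
    by (intro relabel_ident) (simp_all add: row_support_mset_of_mat col_support_mset_of_mat assms)
  then have "count (a $$ (s, t)) l = count (b $$ (s, t)) l" if "s < dim_row b" "t < dim_col b" for s t l
    using that \<phi>(1) \<psi>(1) count_mset_of_mat by metis
  then show ?thesis
    using \<phi>(1) \<psi>(1) by (intro eq_matI multiset_eqI) auto
qed

lemma same_pattern_mset_of_comp_imp_eq:
  assumes "c \<in> Cmp" "c' \<in> Cmp" "same_pattern (mset_of_comp c) (mset_of_comp c')"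
  shows "c = c'"
proof -
  have ne: "mset_of_mat a \<noteq> {#}" if "a \<in> nonempty_matrix_compositions" for a :: "'a multiset mat"
  proof
    assume "mset_of_mat a = {#}"
    then have "{..<dim_row a} = {}" using row_support_mset_of_mat[OF that] by (simp add: row_support_def)
    then show False using that by (simp add: nonempty_matrix_compositions_def lessThan_empty_iff)
  qed
  have "c = None \<longleftrightarrow> c' = None"
    using same_pattern_size[OF assms(3)] assms(1,2) ne by (auto simp: Cmp_def mset_of_comp_def)
  then show ?thesis
    using assms same_pattern_mset_of_mat_imp_eq
    by (auto simp: Cmp_def mset_of_comp_def)
qed

lemma mset_of_mat_surj:
  assumes rows: "row_support w = {..<m}" and cols: "col_support w = {..<n}" and "w \<noteq> {#}"
  shows "\<exists>a\<in>nonempty_matrix_compositions. mset_of_mat a = w"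
proof -
  define a where "a = Matrix.mat m n (\<lambda>p. image_mset snd (filter_mset (\<lambda>q. fst q = p) w))"
  have dim: "dim_row a = m" "dim_col a = n" by (simp_all add: a_def)
  have cnt: "count (image_mset snd (filter_mset (\<lambda>q. fst q = p) v)) l = count v (p, l)"
    for p l and v :: "((nat \<times> nat) \<times> 'a) multiset"
    by (induction v) auto
  have bnd: "s < m \<and> t < n" if "((s, t), l) \<in># w" for s t l
  proof -
    have "s \<in> row_support w" "t \<in> col_support w" using that by (force simp: row_support_def col_support_def)+
    then show ?thesis by (simp add: rows cols)
  qed
  have "mset_of_mat a = w"
  proof (rule multiset_eqI)
    fix p show "count (mset_of_mat a) p = count w p"
    proof (cases p)
      case (Pair st l)
      then obtain s t where "p = ((s, t), l)" by (cases st) auto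
      then show ?thesis using bnd[of s t l]
        by (auto simp: count_mset_of_mat dim cnt a_def not_in_iff[symmetric])
    qed
  qed
  moreover have "\<exists>t<n. a $$ (s, t) \<noteq> {#}" if "s < m" for s
  proof -
    have "s \<in> row_support w" using that rows by simp
    then obtain t l where "((s, t), l) \<in># w" by (auto simp: row_support_def)
    then show ?thesis using \<open>mset_of_mat a = w\<close> mem_mset_of_mat dim by force
  qed
  moreover have "\<exists>s<m. a $$ (s, t) \<noteq> {#}" if "t < n" for t
  proof -
    have "t \<in> col_support w" using that cols by simp
    then obtain s l where "((s, t), l) \<in># w" by (auto simp: col_support_def)
    then show ?thesis using \<open>mset_of_mat a = w\<close> mem_mset_of_mat dim by force
  qed
  moreover have "row_support w \<noteq> {}" "col_support w \<noteq> {}"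
    using \<open>w \<noteq> {#}\<close> by (auto simp: row_support_def col_support_def)
  then have "m \<ge> 1" "n \<ge> 1" by (auto simp: rows cols lessThan_empty_iff)
  ultimately show ?thesis
    by (intro bexI[of _ a]) (auto simp: nonempty_matrix_compositions_def dim)
qed

text \<open>
  Counting smaller elements gives the relabelling that closes the gaps in a set of indices.
\<close>

lemma strict_mono_on_position:
  assumes "finite (A :: nat set)"
  defines "position \<equiv> \<lambda>i. card {r \<in> A. r < i}"
  shows "strict_mono_on A position" and "position ` A = {..<card A}"
proof -
  show mono: "strict_mono_on A position"
  proof (rule strict_mono_onI)
    fix r s assume "r \<in> A" "s \<in> A" "r < s"
    then show "position r < position s"
      unfolding position_def using assms(1) by (intro psubset_card_mono) auto
  qed
  have "position ` A \<subseteq> {..<card A}"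
    unfolding position_def using assms(1) by (auto intro!: psubset_card_mono)
  moreover have "card (position ` A) = card A"
    by (rule card_image[OF strict_mono_on_imp_inj_on[OF mono]])
  ultimately show "position ` A = {..<card A}" by (intro card_subset_eq) auto
qed

text \<open>
  Closing the gaps between the rows and columns that occur in \<open>w\<close> leaves a matrix without empty
  rows and columns.
\<close>

lemma ex_composition_same_pattern: "\<exists>c\<in>Cmp. same_pattern (mset_of_comp c) w"
proof (cases "w = {#}")
  case True
  then have "same_pattern (mset_of_comp None) w"
    by (auto simp: mset_of_comp_def same_pattern_def row_support_def col_support_def strict_mono_on_def)
  then show ?thesis by (auto simp: Cmp_def)
next
  case False
  define \<phi> where "\<phi> = (\<lambda>i. card {r \<in> row_support w. r < i})"
  define \<psi> where "\<psi> = (\<lambda>j. card {r \<in> col_support w. r < j})"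
  have fin: "finite (row_support w)" "finite (col_support w)" by (auto simp: row_support_def col_support_def)
  have "row_support (relabel \<phi> \<psi> w) = {..<card (row_support w)}" "col_support (relabel \<phi> \<psi> w) = {..<card (col_support w)}"
    unfolding row_support_relabel col_support_relabel \<phi>_def \<psi>_def
    using strict_mono_on_position(2) fin by auto
  then obtain a where a: "a \<in> nonempty_matrix_compositions" "mset_of_mat a = relabel \<phi> \<psi> w"
    using mset_of_mat_surj[of "relabel \<phi> \<psi> w"] False by (metis image_mset_is_empty_iff)
  have "same_pattern w (mset_of_mat a)"
    using strict_mono_on_position(1) fin unfolding same_pattern_def a(2) \<phi>_def \<psi>_def by blast
  then show ?thesis
    using a(1) same_pattern_sym by (intro bexI[of _ "Some a"]) (auto simp: Cmp_def mset_of_comp_def)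
qed

text \<open>
  A row or column of a composition contains a letter, so the total degree bounds both dimensions. The
  representatives are then multisets of bounded size over a finite set.
\<close>

lemma finite_compositions_size_le:
  "finite {c \<in> Cmp :: 'd::finite multiset mat option set. size (mset_of_comp c) \<le> n}"
proof (rule inj_on_finite)
  show "inj_on mset_of_comp {c \<in> Cmp :: 'd multiset mat option set. size (mset_of_comp c) \<le> n}"
  proof (rule inj_onI)
    fix c c' :: "'d multiset mat option"
    assume "c \<in> {c \<in> Cmp. size (mset_of_comp c) \<le> n}" "c' \<in> {c \<in> Cmp. size (mset_of_comp c) \<le> n}"
      and eq: "mset_of_comp c = mset_of_comp c'"
    moreover have "same_pattern (mset_of_comp c) (mset_of_comp c')"
      unfolding same_pattern_def eq
      by (intro exI[of _ id]) (auto simp: relabel_ident strict_mono_on_def)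
    ultimately show "c = c'" by (intro same_pattern_mset_of_comp_imp_eq) auto
  qed
  show "mset_of_comp ` {c \<in> Cmp :: 'd multiset mat option set. size (mset_of_comp c) \<le> n}
      \<subseteq> msets_le (({..<n} \<times> {..<n}) \<times> UNIV) n"
  proof clarify
    fix c :: "'d multiset mat option"
    assume c: "c \<in> Cmp" "size (mset_of_comp c) \<le> n"
    have "set_mset (mset_of_comp c) \<subseteq> ({..<n} \<times> {..<n}) \<times> UNIV"
    proof (cases c)
      case None
      then show ?thesis by (simp add: mset_of_comp_def)
    next
      case (Some a)
      then have a: "a \<in> nonempty_matrix_compositions" "size (mset_of_mat a) \<le> n"
        using c by (auto simp: Cmp_def mset_of_comp_def)
      have sz: "card (h ` set_mset w) \<le> size w" for h :: "_ \<Rightarrow> nat" and w :: "((nat \<times> nat) \<times> 'd) multiset"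
        by (induction w) (auto simp: card_insert_if)
      have "dim_row a \<le> n" "dim_col a \<le> n"
        using sz[of "\<lambda>p. fst (fst p)" "mset_of_mat a"] sz[of "\<lambda>p. snd (fst p)" "mset_of_mat a"]
          row_support_mset_of_mat[OF a(1)] col_support_mset_of_mat[OF a(1)] a(2)
        by (auto simp: row_support_def col_support_def)
      then show ?thesis using Some by (auto simp: mset_of_comp_def mem_mset_of_mat)
    qed
    then show "mset_of_comp c \<in> msets_le (({..<n} \<times> {..<n}) \<times> UNIV) n"
      using c(2) by (simp add: msets_le_def)
  qed
qed (auto intro: finite_msets_le)

section \<open>Sums signature coefficients as quasisymmetric series\<close>

text \<open>
  The value zero outside \<open>Npos2\<close> removes the members of a class that use an index zero, to which no
  chains correspond.
\<close>

definition weight :: "('k::comm_ring_1, 'd::finite) evC \<Rightarrow> (nat \<times> nat) \<times> 'd \<Rightarrow> 'k"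
  where "weight X = (\<lambda>(i, l). if i \<in> Npos2 then vec_nth (\<delta> X i) l else 0)"

text \<open>
  The sum of all monomials equivalent to \<open>v\<close>, the analogue of a monomial quasisymmetric function.
\<close>

definition pattern_series ::
    "((nat \<times> nat) \<times> 'd) multiset \<Rightarrow> ((nat \<times> nat) \<times> 'd) multiset \<Rightarrow> 'k::zero_neq_one"
  where "pattern_series v w = (if same_pattern v w then 1 else 0)"

lemma finite_weight_support:
  fixes X :: "('k::comm_ring_1, 'd::finite) evC"
  shows "finite {p. weight X p \<noteq> 0}"
proof (rule finite_subset)
  show "{p. weight X p \<noteq> 0} \<subseteq> {i \<in> Npos2. \<delta> X i \<noteq> 0} \<times> UNIV"
    by (auto simp: weight_def split: if_splits)
  show "finite ({i \<in> Npos2. \<delta> X i \<noteq> 0} \<times> (UNIV :: 'd set))"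
    using \<delta>_in_evZ_funs[of X] by (simp add: evZ_funs_def)
qed

lemma degree_le_pattern_series: "degree_le (pattern_series v) (size v)"
  by (auto simp: degree_le_def pattern_series_def same_pattern_size split: if_splits)

lemma quasisymmetric_pattern_series:
  fixes v :: "((nat \<times> nat) \<times> 'd) multiset"
  shows "quasisymmetric (pattern_series v)"
  unfolding quasisymmetric_def
proof (intro allI impI)
  fix w w' :: "((nat \<times> nat) \<times> 'd) multiset"
  assume "same_pattern w w'"
  then have "same_pattern v w \<longleftrightarrow> same_pattern v w'"
    by (meson same_pattern_sym same_pattern_trans)
  then show "pattern_series v w = pattern_series v w'" by (simp add: pattern_series_def)
qed

lemma monom_at_sum:
  "finite I \<Longrightarrow> monom_at x (\<Sum>i\<in>I. w i) = (\<Prod>i\<in>I. monom_at x (w i))"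
  by (induction I rule: finite_induct) (auto simp: monom_at_def)

lemma monom_at_image: "monom_at x (image_mset h w) = monom_at (x \<circ> h) w"
  by (simp add: monom_at_def image_mset.compositionality o_def)

lemma SS_term_eq_monom_at:
  assumes "\<iota> \<in> strict_chains (dim_row a)" "\<kappa> \<in> strict_chains (dim_col a)"
  shows "SS_term (\<delta> X) a (\<iota>, \<kappa>)
    = monom_at (weight X) (relabel ((!) \<iota>) ((!) \<kappa>) (mset_of_mat a))"
proof -
  have "(\<iota> ! s, \<kappa> ! t) \<in> Npos2" if "s < dim_row a" "t < dim_col a" for s t
  proof -
    have "\<iota> ! s \<in> set \<iota>" "\<kappa> ! t \<in> set \<kappa>"
      using assms that by (auto simp: strict_chains_def)
    then show ?thesis using assms by (auto simp: strict_chains_def Npos2_def)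
  qed
  then have "(\<Prod>t<dim_col a. monomial (\<delta> X (\<iota> ! s, \<kappa> ! t)) (a $$ (s, t)))
      = (\<Prod>t<dim_col a. monom_at (weight X \<circ> relabel_var ((!) \<iota>) ((!) \<kappa>) \<circ> Pair (s, t)) (a $$ (s, t)))"
    if "s < dim_row a" for s
    using that by (intro prod.cong) (auto simp: monomial_def monom_at_def weight_def)
  then have "SS_term (\<delta> X) a (\<iota>, \<kappa>) = (\<Prod>s<dim_row a. \<Prod>t<dim_col a.
      monom_at (weight X \<circ> relabel_var ((!) \<iota>) ((!) \<kappa>) \<circ> Pair (s, t)) (a $$ (s, t)))"
    by (simp add: SS_term_def)
  also have "\<dots> = monom_at (weight X) (relabel ((!) \<iota>) ((!) \<kappa>) (mset_of_mat a))"
    by (simp add: mset_of_mat_def monom_at_image monom_at_sum prod.cartesian_product split_def)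
  finally show ?thesis .
qed

lemma strict_chains_strict_mono_on:
  "\<iota> \<in> strict_chains m \<Longrightarrow> strict_mono_on {..<m} ((!) \<iota>)"
  by (auto simp: strict_chains_def strict_mono_on_def sorted_wrt_nth_less)

lemma strict_chains_nth_image: "\<iota> \<in> strict_chains m \<Longrightarrow> (!) \<iota> ` {..<m} = set \<iota>"
  by (auto simp: strict_chains_def set_conv_nth)

lemma strict_chains_eqI:
  "\<iota> \<in> strict_chains m \<Longrightarrow> \<iota>' \<in> strict_chains m \<Longrightarrow> set \<iota> = set \<iota>' \<Longrightarrow> \<iota> = \<iota>'"
  by (auto simp: strict_chains_def intro: strict_sorted_equal)

lemma strict_chains_map:
  assumes "strict_mono_on {..<m} \<phi>" "\<phi> ` {..<m} \<subseteq> {1..}"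
  shows "map \<phi> [0..<m] \<in> strict_chains m"
  using assms
  by (auto simp: strict_chains_def sorted_wrt_iff_nth_less strict_mono_on_def image_subset_iff)

text \<open>
  The chains can be read off from the monomial as its sets of rows and columns, because every row and
  every column of \<open>a\<close> contains a letter.
\<close>

lemma inj_on_relabel_strict_chains:
  assumes "a \<in> nonempty_matrix_compositions"
  shows "inj_on (\<lambda>(\<iota>, \<kappa>). relabel ((!) \<iota>) ((!) \<kappa>) (mset_of_mat a))
    (strict_chains (dim_row a) \<times> strict_chains (dim_col a))"
proof (rule inj_onI, clarify)
  fix \<iota> \<kappa> \<iota>' \<kappa>'
  assume c: "\<iota> \<in> strict_chains (dim_row a)" "\<kappa> \<in> strict_chains (dim_col a)"
      "\<iota>' \<in> strict_chains (dim_row a)" "\<kappa>' \<in> strict_chains (dim_col a)"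
    and eq: "relabel ((!) \<iota>) ((!) \<kappa>) (mset_of_mat a) = relabel ((!) \<iota>') ((!) \<kappa>') (mset_of_mat a)"
  have "set \<iota> = set \<iota>'" "set \<kappa> = set \<kappa>'"
    using arg_cong[OF eq, of row_support] arg_cong[OF eq, of col_support] c
    by (simp_all add: row_support_relabel col_support_relabel row_support_mset_of_mat col_support_mset_of_mat assms
        strict_chains_nth_image)
  then show "\<iota> = \<iota>' \<and> \<kappa> = \<kappa>'" using c strict_chains_eqI by blast
qed

lemma \<Psi>_eq_eval_series_None:
  fixes X :: "('k::comm_ring_1, 'd::finite) evC"
  shows "\<Psi> None X = eval_series (pattern_series (mset_of_comp None)) (weight X)"
proof -
  have *: "same_pattern {#} w \<longleftrightarrow> w = {#}" for w :: "((nat \<times> nat) \<times> 'd) multiset"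
    by (auto simp: same_pattern_def row_support_def col_support_def strict_mono_on_def)
  have "eval_series (pattern_series (mset_of_comp None)) (weight X)
      = (\<Sum>w\<in>{{#}}. pattern_series (mset_of_comp None) w * monom_at (weight X) w)"
    by (rule eval_series_eq_sum) (auto simp: pattern_series_def mset_of_comp_def * split: if_splits)
  then show ?thesis
    by (simp add: \<Psi>_def pattern_series_def mset_of_comp_def * monom_at_def)
qed

text \<open>
  The pairs of chains with a non-zero summand are in bijection with the monomials equivalent to
  \<open>a\<close> that do not vanish at \<open>\<delta> X\<close>.
\<close>

lemma \<Psi>_eq_eval_series_Some:
  assumes a: "a \<in> nonempty_matrix_compositions"
  shows "\<Psi> (Some a) X = eval_series (pattern_series (mset_of_mat a)) (weight X)"
proof -
  let ?C = "strict_chains (dim_row a) \<times> strict_chains (dim_col a)"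
  let ?place = "\<lambda>(\<iota>, \<kappa>). relabel ((!) \<iota>) ((!) \<kappa>) (mset_of_mat a)"
  define T where "T = {x \<in> ?C. SS_term (\<delta> X) a x \<noteq> 0}"
  have fin: "finite T"
    unfolding T_def by (rule finite_SS_terms[OF \<delta>_in_evZ_funs a])
  have term_eq: "SS_term (\<delta> X) a x = monom_at (weight X) (?place x)" if "x \<in> ?C" for x
    using that SS_term_eq_monom_at by auto
  have pat: "same_pattern (mset_of_mat a) (?place x)" if "x \<in> ?C" for x
    using that strict_chains_strict_mono_on
    by (fastforce simp: same_pattern_def row_support_mset_of_mat[OF a] col_support_mset_of_mat[OF a])
  have "\<Psi> (Some a) X = (\<Sum>x\<in>T. SS_term (\<delta> X) a x)"
    using fin by (simp add: \<Psi>_def sum.G_def T_def)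
  also have "\<dots> = (\<Sum>x\<in>T. pattern_series (mset_of_mat a) (?place x) * monom_at (weight X) (?place x))"
    using term_eq pat by (intro sum.cong) (auto simp: T_def pattern_series_def)
  also have "\<dots> = (\<Sum>w\<in>?place ` T. pattern_series (mset_of_mat a) w * monom_at (weight X) w)"
    using inj_on_relabel_strict_chains[OF a]
    by (subst sum.reindex) (auto simp: T_def intro: inj_on_subset)
  also have "\<dots> = eval_series (pattern_series (mset_of_mat a)) (weight X)"
  proof (rule eval_series_eq_sum[symmetric])
    fix w
    assume "pattern_series (mset_of_mat a) w * monom_at (weight X) w \<noteq> 0"
    then have pw: "same_pattern (mset_of_mat a) w" and nz: "monom_at (weight X) w \<noteq> 0"
      by (auto simp: pattern_series_def split: if_splits)
    obtain \<phi> \<psi> where mono: "strict_mono_on {..<dim_row a} \<phi>" "strict_mono_on {..<dim_col a} \<psi>"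
        and w: "w = relabel \<phi> \<psi> (mset_of_mat a)"
      using pw unfolding same_pattern_def row_support_mset_of_mat[OF a] col_support_mset_of_mat[OF a] by blast
    \<comment> \<open>The chains are the values of the relabelling on the rows and columns of \<open>a\<close>.\<close>
    have "fst p \<in> Npos2" if "p \<in># w" for p
    proof -
      have "weight X p \<noteq> 0" using set_mset_if_monom_at_nonzero[OF nz] that by blast
      then show ?thesis by (auto simp: weight_def split: if_splits prod.splits)
    qed
    then have "row_support w \<subseteq> {1..}" "col_support w \<subseteq> {1..}"
      by (fastforce simp: row_support_def col_support_def Npos2_def)+
    then have chains: "(map \<phi> [0..<dim_row a], map \<psi> [0..<dim_col a]) \<in> ?C"
      using mono by (auto simp: w row_support_relabel col_support_relabel row_support_mset_of_mat[OF a]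
          col_support_mset_of_mat[OF a] intro!: strict_chains_map)
    have w2: "?place (map \<phi> [0..<dim_row a], map \<psi> [0..<dim_col a]) = w"
      unfolding w prod.case by (intro image_mset_cong) (auto simp: mem_mset_of_mat)
    show "w \<in> ?place ` T"
      using chains nz w2 term_eq[OF chains] unfolding T_def by (intro image_eqI) auto
  qed (simp add: fin)
  finally show ?thesis .
qed

lemma \<Psi>_eq_eval_series:
  assumes "c \<in> Cmp"
  shows "\<Psi> c X = eval_series (pattern_series (mset_of_comp c)) (weight X)"
  using assms \<Psi>_eq_eval_series_None \<Psi>_eq_eval_series_Some
  by (auto simp: Cmp_def mset_of_comp_def)

section \<open>The algebra of quasisymmetric functions of the increments\<close>

text \<open>
  Membership in this set does not mention linear combinations, which makes closure under products
  accessible; it turns out to be the span of \<open>\<Psi>\<close>.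
\<close>

definition QSym_funs :: "(('k::comm_ring_1, 'd::finite) evC \<Rightarrow> 'k) set"
  where "QSym_funs =
    {F. \<exists>f n. quasisymmetric f \<and> degree_le f n \<and> F = (\<lambda>X. eval_series f (weight X))}"

lemma QSym_funsE:
  assumes "F \<in> QSym_funs"
  obtains f n where "quasisymmetric f" "degree_le f n" "\<And>X. F X = eval_series f (weight X)"
  using assms by (auto simp: QSym_funs_def)

lemma \<Psi>_in_QSym_funs: "c \<in> Cmp \<Longrightarrow> \<Psi> c \<in> QSym_funs"
  unfolding QSym_funs_def
  using \<Psi>_eq_eval_series quasisymmetric_pattern_series degree_le_pattern_series by blast

lemma QSym_funs_mult: "F \<in> QSym_funs \<Longrightarrow> G \<in> QSym_funs \<Longrightarrow> F * G \<in> QSym_funs"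
proof -
  assume "F \<in> QSym_funs" "G \<in> QSym_funs"
  then obtain f n g m where f: "quasisymmetric f" "degree_le f n" "\<And>X. F X = eval_series f (weight X)"
    and g: "quasisymmetric g" "degree_le g m" "\<And>X. G X = eval_series g (weight X)"
    by (metis QSym_funsE)
  have "F * G = (\<lambda>X. eval_series (cauchy_product f g) (weight X))"
    using f g by (simp add: fun_eq_iff eval_series_cauchy_product[OF finite_weight_support])
  then show ?thesis unfolding QSym_funs_def
    using quasisymmetric_cauchy_product[OF f(1) g(1)] degree_le_cauchy_product[OF f(2) g(2)] by blast
qed

lemma subspace_QSym_funs:
  "fun_module.subspace (QSym_funs :: (('k::comm_ring_1, 'd::finite) evC \<Rightarrow> 'k) set)"
proof (rule fun_module.subspaceI)
  have "(\<lambda>X. eval_series (\<lambda>_. 0) (weight X)) = (0 :: ('k, 'd) evC \<Rightarrow> 'k)"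
    by (simp add: fun_eq_iff eval_series_def sum.G_def)
  then show "(0 :: ('k, 'd) evC \<Rightarrow> 'k) \<in> QSym_funs" unfolding QSym_funs_def
    by (auto simp: quasisymmetric_def degree_le_def intro!: exI[of _ "\<lambda>_. 0"])
next
  fix F G :: "('k, 'd) evC \<Rightarrow> 'k"
  assume "F \<in> QSym_funs" "G \<in> QSym_funs"
  then obtain f n g m where f: "quasisymmetric f" "degree_le f n" "\<And>X. F X = eval_series f (weight X)"
    and g: "quasisymmetric g" "degree_le g m" "\<And>X. G X = eval_series g (weight X)"
    by (metis QSym_funsE)
  have deg: "degree_le (\<lambda>w. f w + g w) (n + m)"
    unfolding degree_le_def
    by (metis add.right_neutral degree_le_def f(2) g(2) trans_le_add1 trans_le_add2)
  have "(F + G) X = eval_series (\<lambda>w. f w + g w) (weight X)" for X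
    unfolding plus_fun_def f(3) g(3)
      eval_series_eq_sum_msets_le[OF finite_weight_support deg order.refl]
      eval_series_eq_sum_msets_le[OF finite_weight_support f(2) le_add1[of n m]]
      eval_series_eq_sum_msets_le[OF finite_weight_support g(2) le_add2[of m n]]
    by (simp add: distrib_right sum.distrib)
  then have "F + G = (\<lambda>X. eval_series (\<lambda>w. f w + g w) (weight X))" by (rule ext)
  moreover have "quasisymmetric (\<lambda>w. f w + g w)"
    using f(1) g(1) by (simp add: quasisymmetric_def)
  ultimately show "F + G \<in> QSym_funs" unfolding QSym_funs_def using deg by blast
next
  fix r and F :: "('k, 'd) evC \<Rightarrow> 'k"
  assume "F \<in> QSym_funs"
  then obtain f n where f: "quasisymmetric f" "degree_le f n" "\<And>X. F X = eval_series f (weight X)"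
    by (metis QSym_funsE)
  have deg: "degree_le (\<lambda>w. r * f w) n"
    using f(2) unfolding degree_le_def by (metis mult_zero_right)
  have "fun_scale r F = (\<lambda>X. eval_series (\<lambda>w. r * f w) (weight X))"
    using f(3)
    by (simp add: fun_eq_iff fun_scale_def
        eval_series_eq_sum_msets_le[OF finite_weight_support deg order.refl]
        eval_series_eq_sum_msets_le[OF finite_weight_support f(2) order.refl]
        sum_distrib_left mult.assoc)
  moreover have "quasisymmetric (\<lambda>w. r * f w)"
    using f(1) unfolding quasisymmetric_def by metis
  ultimately show "fun_scale r F \<in> QSym_funs" unfolding QSym_funs_def using deg by blast
qed

text \<open>
  Exactly one composition lies in the class of \<open>w\<close>. If its degree exceeds \<open>n\<close>, then so does
  that of \<open>w\<close>, and both sides vanish.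
\<close>

lemma quasisymmetric_eq_sum_pattern_series:
  fixes f :: "((nat \<times> nat) \<times> 'd::finite) multiset \<Rightarrow> 'k::comm_ring_1"
  assumes "quasisymmetric f" "degree_le f n"
  shows "f w = (\<Sum>c | c \<in> Cmp \<and> size (mset_of_comp c) \<le> n.
    f (mset_of_comp c) * pattern_series (mset_of_comp c) w)"
proof -
  let ?C = "{c. c \<in> (Cmp :: 'd multiset mat option set) \<and> size (mset_of_comp c) \<le> n}"
  obtain c where c: "c \<in> Cmp" "same_pattern (mset_of_comp c) w"
    using ex_composition_same_pattern by blast
  have "pattern_series (mset_of_comp c') w = (if c' = c then 1 else 0 :: 'k)" if "c' \<in> ?C" for c'
    using that c same_pattern_mset_of_comp_imp_eq[of c' c]
    by (auto simp: pattern_series_def dest: same_pattern_trans[OF _ same_pattern_sym[OF c(2)]])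
  then have "(\<Sum>c'\<in>?C. f (mset_of_comp c') * pattern_series (mset_of_comp c') w)
      = (\<Sum>c'\<in>?C. if c' = c then f (mset_of_comp c') else 0)"
    by (intro sum.cong) auto
  also have "\<dots> = (if c \<in> ?C then f (mset_of_comp c) else 0)"
    using finite_compositions_size_le[of n, where 'd = 'd] by (rule sum.delta)
  also have "\<dots> = f w"
  proof -
    have "f w = f (mset_of_comp c)" using assms(1) c(2) by (simp add: quasisymmetric_def)
    then show ?thesis using c(1) assms(2) by (auto simp: degree_le_def)
  qed
  finally show ?thesis ..
qed

lemma QSym_funs_subset_span: "QSym_funs \<subseteq> fun_module.span (\<Psi> ` Cmp)"
proof
  fix F :: "('a, 'b) evC \<Rightarrow> 'a"
  assume "F \<in> QSym_funs"
  then obtain f n where f: "quasisymmetric f" "degree_le f n" "\<And>X. F X = eval_series f (weight X)"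
    by (metis QSym_funsE)
  let ?C = "{c. c \<in> (Cmp :: 'b multiset mat option set) \<and> size (mset_of_comp c) \<le> n}"
  have deg: "degree_le (pattern_series (mset_of_comp c) :: _ \<Rightarrow> 'a) n" if "c \<in> ?C" for c
    using that degree_le_pattern_series[of "mset_of_comp c"] unfolding degree_le_def
    by (metis (no_types, lifting) mem_Collect_eq order.trans)
  have "F X = (\<Sum>c\<in>?C. f (mset_of_comp c) * \<Psi> c X)" for X
  proof -
    have "F X = eval_series (\<lambda>w. \<Sum>c\<in>?C. f (mset_of_comp c) * pattern_series (mset_of_comp c) w) (weight X)"
      unfolding f(3)
      by (rule arg_cong[of f _ "\<lambda>h. eval_series h (weight X)"])
        (rule ext, rule quasisymmetric_eq_sum_pattern_series[OF f(1,2)])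
    also have "\<dots> = (\<Sum>c\<in>?C. f (mset_of_comp c) * \<Psi> c X)"
    proof -
      have "eval_series (\<lambda>w. \<Sum>c\<in>?C. f (mset_of_comp c) * pattern_series (mset_of_comp c) w) (weight X)
          = (\<Sum>c\<in>?C. f (mset_of_comp c) * eval_series (pattern_series (mset_of_comp c)) (weight X))"
        by (rule eval_series_linear_combination[OF finite_weight_support deg])
      then show ?thesis by (simp add: \<Psi>_eq_eval_series)
    qed
    finally show ?thesis .
  qed
  moreover have "(\<Sum>c\<in>D. h c) X = (\<Sum>c\<in>D. h c X)"
    for D and h :: "'b multiset mat option \<Rightarrow> ('a, 'b) evC \<Rightarrow> 'a" and X
    by (induction D rule: infinite_finite_induct) auto
  ultimately have "F = (\<Sum>c\<in>?C. fun_scale (f (mset_of_comp c)) (\<Psi> c))"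
    by (simp add: fun_eq_iff fun_scale_def)
  also have "\<dots> \<in> fun_module.span (\<Psi> ` Cmp)"
    by (intro fun_module.span_sum fun_module.span_scale fun_module.span_base) auto
  finally show "F \<in> fun_module.span (\<Psi> ` Cmp)" .
qed

lemma span_\<Psi>_eq_QSym_funs: "fun_module.span (\<Psi> ` Cmp) = QSym_funs"
  by (intro fun_module.span_subspace QSym_funs_subset_span subspace_QSym_funs)
    (auto intro: \<Psi>_in_QSym_funs)

theorem corollary2p28:
  shows "is_subalgebra (Modules.module.span fun_scale
    ((\<Psi> :: 'd::finite multiset mat option \<Rightarrow> ('k::idom, 'd) evC \<Rightarrow> 'k) ` Cmp))"
proof -
  have "\<Psi> None = (1 :: ('k, 'd) evC \<Rightarrow> 'k)"
    by (simp add: fun_eq_iff \<Psi>_def)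
  then have "(1 :: ('k, 'd) evC \<Rightarrow> 'k) \<in> QSym_funs"
    by (metis \<Psi>_in_QSym_funs Cmp_def insertI1)
  then show ?thesis
    unfolding is_subalgebra_def span_\<Psi>_eq_QSym_funs
    using subspace_QSym_funs QSym_funs_mult by blast
qed

end
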